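(* Let $G$ be a nilpotent topological group. Any irreducible affine isometric action $\alpha$ of $G$ on a Hilbert space $\mathcal H$ is given by a continuous homomorphism $b:G\to\mathcal H$ such that $\mathrm{span}(b(G))$ is dense in $\mathcal H$; that is, $\alpha(g)v=v+b(g)$ for all $g\in G$, $v\in\mathcal H$.
   Context: An affine isometric action of $G$ on $\mathcal H$ has the form $\alpha(g)v=\pi(g)v+b(g)$ with $\pi$ a continuous unitary representation and $b:G\to\mathcal H$ continuous with $b(gh)=b(g)+\pi(g)b(h)$. It is irreducible if $\mathcal H$ has no non-empty, closed, proper $\alpha(G)$-invariant affine subspace. A homomorphism $G\to\mathcal H$ means a homomorphism to the additive group of $\mathcal H$. *)

theory Defs
  imports "HOL-Analysis.Analysis" "HOL-Algebra.Generated_Groups"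
begin

section \<open>Complex Hilbert spaces\<close>

text \<open>
  A complex inner product space is presented on top of its underlying real inner product space
  (whose inner product is the real part of the Hermitian one), so that the norm
  \<open>sqrt (Re (cinner x x))\<close> and its topology are those of \<^class>\<open>real_inner\<close>.
  The Hermitian product is linear in the first argument.
\<close>

class complex_inner = real_inner +
  fixes scaleC :: "complex \<Rightarrow> 'a \<Rightarrow> 'a" (infixr \<open>*\<^sub>C\<close> 75)
    and cinner :: "'a \<Rightarrow> 'a \<Rightarrow> complex"
  assumes scaleC_add_right: "c *\<^sub>C (x + y) = c *\<^sub>C x + c *\<^sub>C y"
    and scaleC_add_left: "(c + d) *\<^sub>C x = c *\<^sub>C x + d *\<^sub>C x"
    and scaleC_scaleC: "c *\<^sub>C (d *\<^sub>C x) = (c * d) *\<^sub>C x"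
    and scaleC_of_real: "complex_of_real r *\<^sub>C x = r *\<^sub>R x"
    and cinner_commute: "cinner x y = cnj (cinner y x)"
    and cinner_add_left: "cinner (x + y) z = cinner x z + cinner y z"
    and cinner_scaleC_left: "cinner (c *\<^sub>C x) y = c * cinner x y"
    and Re_cinner: "Re (cinner x y) = inner x y"

class chilbert_space = complex_inner + complete_space

instantiation complex :: chilbert_space
begin
definition scaleC_complex :: "complex \<Rightarrow> complex \<Rightarrow> complex" where
  "scaleC_complex c x = c * x"
definition cinner_complex :: "complex \<Rightarrow> complex \<Rightarrow> complex" where
  "cinner_complex x y = x * cnj y"
instance
  by standard
    (auto simp: scaleC_complex_def cinner_complex_def algebra_simps scaleR_conv_of_real inner_complex_def)
end

lemma vector_space_scaleC: "vector_space (scaleC :: complex \<Rightarrow> 'a \<Rightarrow> 'a::complex_inner)"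
proof
  show "1 *\<^sub>C x = x" for x :: 'a
    using scaleC_of_real[of 1 x] by simp
qed (simp_all add: scaleC_add_right scaleC_add_left scaleC_scaleC)

global_interpretation complex_vector: vector_space "scaleC :: complex \<Rightarrow> 'a \<Rightarrow> 'a::complex_inner"
  defines cspan = complex_vector.span
  by (rule vector_space_scaleC)

abbreviation clinear :: "('a::complex_inner \<Rightarrow> 'b::complex_inner) \<Rightarrow> bool" where
  "clinear \<equiv> Vector_Spaces.linear scaleC scaleC"

definition caffine :: "'a::complex_inner set \<Rightarrow> bool" where
  "caffine S \<longleftrightarrow>
     (\<forall>x\<in>S. \<forall>y\<in>S. \<forall>c d. c + d = 1 \<longrightarrow> c *\<^sub>C x + d *\<^sub>C y \<in> S)"

definition unitary :: "('a::complex_inner \<Rightarrow> 'a) \<Rightarrow> bool" where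
  "unitary U \<longleftrightarrow> clinear U \<and> surj U \<and> (\<forall>x y. cinner (U x) (U y) = cinner x y)"

section \<open>Nilpotent topological groups\<close>

locale topological_group = group G for G (structure) and T :: "'g topology" +
  assumes topspace_eq: "topspace T = carrier G"
    and continuous_mult: "continuous_map (prod_topology T T) T (\<lambda>(x, y). x \<otimes> y)"
    and continuous_inv: "continuous_map T T (\<lambda>x. inv x)"

fun lower_central_series :: "('g, 'm) monoid_scheme \<Rightarrow> nat \<Rightarrow> 'g set" where
  "lower_central_series G 0 = carrier G"
| "lower_central_series G (Suc n) = generate G
     (\<Union>x\<in>lower_central_series G n. \<Union>y\<in>carrier G.
        { x \<otimes>\<^bsub>G\<^esub> y \<otimes>\<^bsub>G\<^esub> inv\<^bsub>G\<^esub> x \<otimes>\<^bsub>G\<^esub> inv\<^bsub>G\<^esub> y })"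

locale nilpotent_group = group G for G (structure) +
  assumes nilpotent: "\<exists>n. lower_central_series G n = {\<one>}"

section \<open>Affine isometric actions\<close>

text \<open>Representations are continuous for the strong operator topology.\<close>

definition continuous_unitary_rep ::
    "('g, 'm) monoid_scheme \<Rightarrow> 'g topology \<Rightarrow> ('g \<Rightarrow> 'h::chilbert_space \<Rightarrow> 'h) \<Rightarrow> bool" where
  "continuous_unitary_rep G T \<pi> \<longleftrightarrow>
     (\<forall>g\<in>carrier G. unitary (\<pi> g)) \<and>
     (\<forall>g\<in>carrier G. \<forall>h\<in>carrier G. \<pi> (g \<otimes>\<^bsub>G\<^esub> h) = \<pi> g \<circ> \<pi> h) \<and>
     (\<forall>v. continuous_map T euclidean (\<lambda>g. \<pi> g v))"

definition continuous_cocycle ::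
    "('g, 'm) monoid_scheme \<Rightarrow> 'g topology \<Rightarrow> ('g \<Rightarrow> 'h::chilbert_space \<Rightarrow> 'h) \<Rightarrow> ('g \<Rightarrow> 'h) \<Rightarrow> bool" where
  "continuous_cocycle G T \<pi> b \<longleftrightarrow>
     continuous_map T euclidean b \<and>
     (\<forall>g\<in>carrier G. \<forall>h\<in>carrier G. b (g \<otimes>\<^bsub>G\<^esub> h) = b g + \<pi> g (b h))"

definition affine_isometric_action ::
    "('g, 'm) monoid_scheme \<Rightarrow> 'g topology \<Rightarrow> ('g \<Rightarrow> 'h::chilbert_space \<Rightarrow> 'h) \<Rightarrow> bool" where
  "affine_isometric_action G T \<alpha> \<longleftrightarrow>
     (\<exists>\<pi> b. continuous_unitary_rep G T \<pi> \<and> continuous_cocycle G T \<pi> b \<and>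
        (\<forall>g\<in>carrier G. \<forall>v. \<alpha> g v = \<pi> g v + b g))"

definition irreducible_action ::
    "('g, 'm) monoid_scheme \<Rightarrow> ('g \<Rightarrow> 'h::chilbert_space \<Rightarrow> 'h) \<Rightarrow> bool" where
  "irreducible_action G \<alpha> \<longleftrightarrow>
     \<not> (\<exists>S. S \<noteq> {} \<and> closed S \<and> S \<noteq> UNIV \<and> caffine S \<and> (\<forall>g\<in>carrier G. \<alpha> g ` S \<subseteq> S))"

definition continuous_additive_hom ::
    "('g, 'm) monoid_scheme \<Rightarrow> 'g topology \<Rightarrow> ('g \<Rightarrow> 'h::chilbert_space) \<Rightarrow> bool" where
  "continuous_additive_hom G T b \<longleftrightarrow>
     continuous_map T euclidean b \<and>
     (\<forall>g\<in>carrier G. \<forall>h\<in>carrier G. b (g \<otimes>\<^bsub>G\<^esub> h) = b g + b h)"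

end

theory Submission
  imports Defs
begin

text \<open>
  If \<open>z\<close> is central, then \<open>(\<pi> z - 1) (b g) = (\<pi> g - 1) (b z)\<close>. On a spectral subspace of \<open>\<pi> z\<close>
  away from \<open>1\<close> the operator \<open>\<pi> z - 1\<close> is invertible and \<open>b\<close> becomes a coboundary, so the
  projected action has a fixed point, whose preimage is a proper invariant closed affine subspace.
  Hence \<open>\<pi> z = 1\<close>, and nilpotency propagates this from the bottom of the lower central series to all
  of \<open>G\<close>. Once \<open>\<pi>\<close> is trivial, the closed span of \<open>b(G)\<close> is itself invariant. No spectral theorem
  is needed: a non-orthogonal substitute for the spectral projection is \<open>A + \<bar>A\<bar>\<close> for the
  self-adjoint operator \<open>A = (2 - \<pi> z - (\<pi> z)\<^sup>-\<^sup>1) / 5 - \<epsilon>\<close>, where \<open>\<bar>A\<bar>\<close> is the square root of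
  \<open>A\<^sup>2\<close>.
\<close>

section \<open>Square roots and resolvents of bounded operators on a Banach space\<close>

instance chilbert_space \<subseteq> banach ..

text \<open>The operator \<open>1 - Y\<close> is the square root of \<open>1 - T\<close>. The iteration \<open>Y \<mapsto> (T + Y\<^sup>2) / 2\<close> is
  dominated in norm, increments included, by the scalar iteration \<open>s \<mapsto> (1 + s\<^sup>2) / 2\<close>.\<close>

lemma blinfun_one_minus_sqrt:
  fixes T :: "'a::banach \<Rightarrow>\<^sub>L 'a"
  assumes "norm T \<le> 1"
  obtains Y where "norm Y \<le> 1" "2 *\<^sub>R Y = T + (Y o\<^sub>L Y)"
    "\<And>X. X o\<^sub>L T = T o\<^sub>L X \<Longrightarrow> X o\<^sub>L Y = Y o\<^sub>L X"
proof -
  define Y :: "nat \<Rightarrow> 'a \<Rightarrow>\<^sub>L 'a"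
    where "Y = rec_nat 0 (\<lambda>_ Z. (1/2) *\<^sub>R (T + (Z o\<^sub>L Z)))"
  define s :: "nat \<Rightarrow> real" where "s = rec_nat 0 (\<lambda>_ r. (1 + r * r) / 2)"
  have Y0: "Y 0 = 0" and YS: "\<And>n. Y (Suc n) = (1/2) *\<^sub>R (T + (Y n o\<^sub>L Y n))"
    by (simp_all add: Y_def)
  have s0: "s 0 = 0" and sS: "\<And>n. s (Suc n) = (1 + s n * s n) / 2"
    by (simp_all add: s_def)
  have s01: "0 \<le> s n \<and> s n \<le> 1" for n
  proof (induction n)
    case (Suc n)
    then have "s n * s n \<le> 1" by (simp add: mult_le_one)
    with Suc show ?case by (simp add: sS)
  qed (simp add: s0)
  have Ys: "norm (Y n) \<le> s n" for n
  proof (induction n)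
    case (Suc n)
    have "norm (Y n o\<^sub>L Y n) \<le> norm (Y n) * norm (Y n)"
      by (rule norm_blinfun_compose)
    also have "\<dots> \<le> s n * s n" using Suc s01 by (intro mult_mono) auto
    finally have "norm (T + (Y n o\<^sub>L Y n)) \<le> 1 + s n * s n"
      using assms norm_triangle_ineq[of T "Y n o\<^sub>L Y n"] by linarith
    then show ?case by (simp add: YS sS)
  qed (simp add: Y0 s0)
  have step: "norm (Y (Suc n) - Y n) \<le> s (Suc n) - s n" for n
  proof (induction n)
    case 0
    show ?case using assms by (simp add: YS sS Y0 s0 bounded_bilinear.zero_left[OF bounded_bilinear_blinfun_compose])
  next
    case (Suc n)
    define D where "D = Y (Suc n) - Y n"
    \<comment> \<open>The difference of the squares of \<open>Y (Suc n)\<close> and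
      \<open>Y n\<close> is split as \<open>Y (Suc n)\<close> times \<open>D\<close> plus
      \<open>D\<close> times \<open>Y n\<close>, which requires no commutativity.\<close>
    have eq: "Y (Suc (Suc n)) - Y (Suc n) = (1/2) *\<^sub>R ((Y (Suc n) o\<^sub>L D) + (D o\<^sub>L Y n))"
      unfolding YS[of "Suc n"] D_def
      by (rule blinfun_eqI) (subst (3) YS, simp add: blinfun.bilinear_simps algebra_simps)
    have "norm (Y (Suc n) o\<^sub>L D) \<le> s (Suc n) * (s (Suc n) - s n)"
      using norm_blinfun_compose[of "Y (Suc n)" D] Ys[of "Suc n"] Suc s01[of "Suc n"]
      by (smt (verit) D_def mult_mono norm_ge_zero)
    moreover have "norm (D o\<^sub>L Y n) \<le> (s (Suc n) - s n) * s n"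
      using norm_blinfun_compose[of D "Y n"] Ys[of n] Suc s01[of n]
      by (smt (verit) D_def mult_mono norm_ge_zero)
    ultimately have "norm ((Y (Suc n) o\<^sub>L D) + (D o\<^sub>L Y n))
        \<le> s (Suc n) * (s (Suc n) - s n) + (s (Suc n) - s n) * s n"
      by (meson add_mono norm_triangle_ineq order_trans)
    also have "\<dots> = 2 * (s (Suc (Suc n)) - s (Suc n))"
      unfolding sS[of "Suc n"] by (subst (6) sS) (simp add: field_simps)
    finally show ?case by (simp add: eq)
  qed
  have inc: "incseq s"
    using step by (intro incseq_SucI) (smt (verit) norm_ge_zero)
  have diff: "norm (Y (n + k) - Y n) \<le> s (n + k) - s n" for n k
  proof (induction k)
    case (Suc k)
    have "Y (n + Suc k) - Y n = (Y (Suc (n + k)) - Y (n + k)) + (Y (n + k) - Y n)"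
      by simp
    then show ?case
      using Suc step[of "n + k"] norm_triangle_ineq[of "Y (Suc (n + k)) - Y (n + k)" "Y (n + k) - Y n"]
      by simp
  qed simp
  have "convergent s"
    using inc s01 by (intro Bseq_monoseq_convergent BseqI'[of _ 1]) (auto simp: monoseq_iff)
  then have "Cauchy s" by (rule convergent_Cauchy)
  have "Cauchy Y"
  proof (rule CauchyI')
    fix e :: real assume "0 < e"
    then obtain M where M: "\<And>m n. m \<ge> M \<Longrightarrow> n \<ge> M \<Longrightarrow> norm (s m - s n) < e"
      using CauchyD[OF \<open>Cauchy s\<close>] by blast
    show "\<exists>M. \<forall>m\<ge>M. \<forall>n>m. dist (Y m) (Y n) < e"
    proof (intro exI allI impI)
      fix m n assume "M \<le> m" "m < n"
      then have "norm (Y n - Y m) \<le> s n - s m" using diff[of m "n - m"] by simp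
      then show "dist (Y m) (Y n) < e"
        using M[of n m] \<open>M \<le> m\<close> \<open>m < n\<close> by (simp add: dist_norm norm_minus_commute)
    qed
  qed
  then obtain Z where Z: "Y \<longlonglongrightarrow> Z"
    using Cauchy_convergent_iff convergent_def by blast
  note comp = bounded_bilinear.tendsto[OF bounded_bilinear_blinfun_compose]
  show thesis
  proof
    show "norm Z \<le> 1"
      using Ys s01 by (intro Lim_norm_ubound[OF _ Z]) (auto intro!: always_eventually intro: order_trans)
    have "(\<lambda>n. 2 *\<^sub>R Y (Suc n)) \<longlonglongrightarrow> 2 *\<^sub>R Z"
      by (intro tendsto_intros LIMSEQ_Suc Z)
    moreover have "(\<lambda>n. 2 *\<^sub>R Y (Suc n)) \<longlonglongrightarrow> T + (Z o\<^sub>L Z)"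
      unfolding YS by simp (intro tendsto_intros comp Z)
    ultimately show "2 *\<^sub>R Z = T + (Z o\<^sub>L Z)" by (rule LIMSEQ_unique)
  next
    fix X assume X: "X o\<^sub>L T = T o\<^sub>L X"
    have "X o\<^sub>L Y n = Y n o\<^sub>L X" for n
    proof (induction n)
      case 0
      show ?case by (rule blinfun_eqI) (simp add: Y0)
    next
      case (Suc n)
      show ?case
      proof (rule blinfun_eqI)
        fix v
        have "X (T v) = T (X v)" "\<And>v. X (Y n v) = Y n (X v)"
          using X Suc by (metis blinfun_apply_blinfun_compose)+
        then show "(X o\<^sub>L Y (Suc n)) v = (Y (Suc n) o\<^sub>L X) v"
          by (simp add: YS blinfun.bilinear_simps)
      qed
    qed
    then have "(\<lambda>n. X o\<^sub>L Y n) \<longlonglongrightarrow> (Z o\<^sub>L X)"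
      by (simp only:) (intro comp tendsto_const Z)
    moreover have "(\<lambda>n. X o\<^sub>L Y n) \<longlonglongrightarrow> (X o\<^sub>L Z)"
      by (intro comp tendsto_const Z)
    ultimately show "X o\<^sub>L Z = Z o\<^sub>L X" by (rule LIMSEQ_unique[rotated])
  qed
qed

text \<open>\<open>J\<close> is the inverse of \<open>e + (1 - Y)\<close>, found as the fixed point
  of a contraction with constant \<open>1 / (1 + e)\<close>. A commutator \<open>D\<close> of
  \<open>X\<close> with \<open>J\<close> satisfies \<open>(1 + e) D = Y D\<close>, and
  \<open>norm Y \<le> 1\<close> then forces \<open>D = 0\<close>.\<close>

lemma blinfun_resolvent:
  fixes Y :: "'a::banach \<Rightarrow>\<^sub>L 'a"
  assumes "norm Y \<le> 1" and "e > 0"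
  obtains J where "(1 + e) *\<^sub>R J = id_blinfun + (Y o\<^sub>L J)"
    "\<And>X. X o\<^sub>L Y = Y o\<^sub>L X \<Longrightarrow> X o\<^sub>L J = J o\<^sub>L X"
proof -
  define f where "f = (\<lambda>J. (1 / (1 + e)) *\<^sub>R (id_blinfun + (Y o\<^sub>L J)))"
  have contr: "norm (Y o\<^sub>L D) \<le> norm D" for D :: "'a \<Rightarrow>\<^sub>L 'a"
    using norm_blinfun_compose[of Y D] mult_right_mono[OF assms(1) norm_ge_zero[of D]] by simp
  have "\<exists>!J. f J = J"
  proof (rule banach_fix_type)
    show "\<forall>J. \<forall>K. dist (f J) (f K) \<le> 1 / (1 + e) * dist J K"
    proof (intro allI)
      fix J K
      have "f J - f K = (1 / (1 + e)) *\<^sub>R (Y o\<^sub>L (J - K))"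
        by (rule blinfun_eqI) (simp add: f_def blinfun.bilinear_simps algebra_simps)
      then show "dist (f J) (f K) \<le> 1 / (1 + e) * dist J K"
        using contr[of "J - K"] assms(2) by (simp add: dist_norm divide_right_mono)
    qed
  qed (use assms(2) in auto)
  then obtain J where "f J = J" by blast
  then have "(1 + e) *\<^sub>R J = (1 + e) *\<^sub>R f J" by simp
  also have "\<dots> = id_blinfun + (Y o\<^sub>L J)" using assms(2) by (simp add: f_def)
  finally have J: "(1 + e) *\<^sub>R J = id_blinfun + (Y o\<^sub>L J)" .
  show thesis
  proof (rule that[OF J])
    fix X assume X: "X o\<^sub>L Y = Y o\<^sub>L X"
    define D where "D = (X o\<^sub>L J) - (J o\<^sub>L X)"
    have "(1 + e) *\<^sub>R D = Y o\<^sub>L D"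
    proof (rule blinfun_eqI)
      fix v
      have Jv: "(1 + e) *\<^sub>R J w = w + Y (J w)" for w
        using arg_cong[OF J, of "\<lambda>B. B w"] by (simp add: blinfun.bilinear_simps)
      have "(1 + e) *\<^sub>R X (J v) = X ((1 + e) *\<^sub>R J v)"
        by (simp only: blinfun.scaleR_right)
      also have "\<dots> = X v + Y (X (J v))"
        unfolding Jv using X by (metis blinfun.add_right blinfun_apply_blinfun_compose)
      finally show "((1 + e) *\<^sub>R D) v = (Y o\<^sub>L D) v"
        using Jv[of "X v"] by (simp add: D_def blinfun.bilinear_simps scaleR_diff_right)
    qed
    then have "(1 + e) * norm D = norm (Y o\<^sub>L D)"
      using assms(2) by (metis abs_of_pos add_pos_pos norm_scaleR zero_less_one)
    then have "e * norm D \<le> 0" using contr[of D] by (simp add: algebra_simps)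
    then have "D = 0" using assms(2) by (simp add: mult_le_0_iff)
    then show "X o\<^sub>L J = J o\<^sub>L X" by (simp add: D_def)
  qed
qed

section \<open>Spectral cutoff for a unitary operator\<close>

text \<open>This bound allows the square root of \<open>A\<^sup>2 = 1 - (1 - A\<^sup>2)\<close> to
  be taken. It follows by expanding the squared norm of \<open>x - A (A x)\<close>: the cross term
  is \<open>-2\<close> times the squared norm of \<open>A x\<close>, which outweighs that of
  \<open>A (A x)\<close>.\<close>

lemma self_adjoint_contraction_one_minus_square:
  fixes A :: "'a::real_inner \<Rightarrow>\<^sub>L 'a"
  assumes "norm A \<le> 1" and adj: "\<And>x y. inner (A x) y = inner x (A y)"
  shows "norm (id_blinfun - (A o\<^sub>L A)) \<le> 1"
proof (rule norm_blinfun_bound)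
  fix x
  have "norm (A (A x)) \<le> norm (A x)"
    using norm_blinfun[of A "A x"] mult_right_mono[OF assms(1) norm_ge_zero[of "A x"]] by simp
  then have "(norm (A (A x)))\<^sup>2 \<le> (norm (A x))\<^sup>2" by (simp add: power_mono)
  moreover have "(norm (x - A (A x)))\<^sup>2 = (norm x)\<^sup>2 - 2 * (norm (A x))\<^sup>2 + (norm (A (A x)))\<^sup>2"
    using adj[of "A x" x]
    by (simp add: power2_norm_eq_inner inner_diff_left inner_diff_right inner_commute)
  ultimately have "(norm (x - A (A x)))\<^sup>2 \<le> (norm x)\<^sup>2"
    using zero_le_power2[of "norm (A x)"] by linarith
  then show "norm ((id_blinfun - (A o\<^sub>L A)) x) \<le> 1 * norm x"
    by (simp add: blinfun.bilinear_simps power2_le_iff_abs_le)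
qed simp

text \<open>With \<open>S = (2 - U - V) / 5\<close>, \<open>A = S - \<epsilon>\<close> and \<open>R = \<bar>A\<bar> = 1 - Y\<close>, the operator \<open>C = R + A\<close> satisfies
  \<open>S C = (\<epsilon> + R) C\<close> because \<open>(R - A) (R + A) = 0\<close>, and \<open>\<epsilon> + R\<close> is invertible. If \<open>C = 0\<close> then
  \<open>A = - R \<le> 0\<close>, which fails for small \<open>\<epsilon>\<close> since \<open>5 \<langle>S x, x\<rangle> = \<parallel>U x - x\<parallel>\<^sup>2\<close>.\<close>

lemma unitary_spectral_cutoff:
  fixes U V :: "'a::{real_inner, banach} \<Rightarrow>\<^sub>L 'a"
  assumes iso: "\<And>x. norm (U x) = norm x" "\<And>x. norm (V x) = norm x"
    and adj: "\<And>x y. inner (U x) y = inner x (V y)"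
    and "U x0 \<noteq> x0"
  obtains C J where "C \<noteq> 0" "(2 *\<^sub>R id_blinfun - U - V) o\<^sub>L J o\<^sub>L C = C"
    "\<And>X. X o\<^sub>L U = U o\<^sub>L X \<Longrightarrow> X o\<^sub>L V = V o\<^sub>L X \<Longrightarrow> X o\<^sub>L C = C o\<^sub>L X"
    "\<And>X. X o\<^sub>L U = U o\<^sub>L X \<Longrightarrow> X o\<^sub>L V = V o\<^sub>L X \<Longrightarrow> X o\<^sub>L J = J o\<^sub>L X"
proof -
  have "x0 \<noteq> 0" using assms(4) by (auto simp: blinfun.zero_right)
  \<comment> \<open>\<open>q\<close> is five times the Rayleigh quotient of \<open>S\<close> at
    \<open>x0\<close>. Choosing \<open>5 * e < q\<close> makes \<open>A\<close> strictly positive at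
    \<open>x0\<close>, while \<open>e \<le> 1/5\<close> and the factor \<open>1/5\<close> in
    \<open>S\<close> keep \<open>norm A \<le> 1\<close>.\<close>
  define q where "q = (norm (U x0 - x0))\<^sup>2 / (norm x0)\<^sup>2"
  have "q > 0" using assms(4) \<open>x0 \<noteq> 0\<close> by (simp add: q_def)
  define e where "e = min (1/5) (q / 10)"
  have e: "0 < e" "e \<le> 1/5" "5 * e < q" using \<open>q > 0\<close> by (auto simp: e_def)
  define S where "S = (1/5) *\<^sub>R (2 *\<^sub>R id_blinfun - U - V)"
  define A where "A = S - e *\<^sub>R id_blinfun"
  have Ax: "A x = (2/5 - e) *\<^sub>R x - (1/5) *\<^sub>R U x - (1/5) *\<^sub>R V x" for x
    by (simp add: A_def S_def blinfun.bilinear_simps algebra_simps)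
  have "norm A \<le> 1"
  proof (rule norm_blinfun_bound)
    fix x
    have "norm (A x) \<le> norm ((2/5 - e) *\<^sub>R x) + norm ((1/5) *\<^sub>R U x) + norm ((1/5) *\<^sub>R V x)"
      unfolding Ax by (meson add_right_mono norm_triangle_ineq4 order_trans)
    also have "\<dots> = (4/5 - e) * norm x" using e by (simp only: iso norm_scaleR) (simp add: left_diff_distrib)
    also have "\<dots> \<le> 1 * norm x" using e by (intro mult_right_mono) auto
    finally show "norm (A x) \<le> 1 * norm x" .
  qed simp
  moreover have "inner (A x) y = inner x (A y)" for x y
    using adj[of x y] adj[of y x]
    by (simp add: Ax inner_diff_left inner_diff_right inner_commute)
  ultimately have "norm (id_blinfun - (A o\<^sub>L A)) \<le> 1"
    by (rule self_adjoint_contraction_one_minus_square)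
  then obtain Y where Y: "norm Y \<le> 1" "2 *\<^sub>R Y = (id_blinfun - (A o\<^sub>L A)) + (Y o\<^sub>L Y)"
    and Ycomm: "\<And>X. X o\<^sub>L (id_blinfun - (A o\<^sub>L A)) = (id_blinfun - (A o\<^sub>L A)) o\<^sub>L X \<Longrightarrow> X o\<^sub>L Y = Y o\<^sub>L X"
    by (rule blinfun_one_minus_sqrt) blast
  obtain J where J: "(1 + e) *\<^sub>R J = id_blinfun + (Y o\<^sub>L J)"
    and Jcomm: "\<And>X. X o\<^sub>L Y = Y o\<^sub>L X \<Longrightarrow> X o\<^sub>L J = J o\<^sub>L X"
    by (rule blinfun_resolvent[OF Y(1) e(1)]) blast
  have AY: "X o\<^sub>L Y = Y o\<^sub>L X" if "X o\<^sub>L A = A o\<^sub>L X" for X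
  proof (rule Ycomm, rule blinfun_eqI)
    fix v
    have "X (A v) = A (X v)" for v using that by (metis blinfun_apply_blinfun_compose)
    then show "(X o\<^sub>L (id_blinfun - (A o\<^sub>L A))) v = ((id_blinfun - (A o\<^sub>L A)) o\<^sub>L X) v"
      by (simp add: blinfun.bilinear_simps)
  qed
  define C where "C = id_blinfun - Y + A"
  have UVA: "X o\<^sub>L A = A o\<^sub>L X" if "X o\<^sub>L U = U o\<^sub>L X" "X o\<^sub>L V = V o\<^sub>L X" for X
  proof (rule blinfun_eqI)
    fix v
    have "X (U v) = U (X v)" "X (V v) = V (X v)"
      using that by (metis blinfun_apply_blinfun_compose)+
    then show "(X o\<^sub>L A) v = (A o\<^sub>L X) v" by (simp add: Ax blinfun.bilinear_simps)
  qed
  \<comment> \<open>The commutation rules are applied to \<open>A\<close> and \<open>Y\<close>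
    themselves, whence \<open>refl\<close>.\<close>
  have YA: "A (Y v) = Y (A v)" for v
    using AY[OF refl] by (metis blinfun_apply_blinfun_compose)
  have JY: "Y (J v) = J (Y v)" for v
    using Jcomm[OF refl] by (metis blinfun_apply_blinfun_compose)
  have JA: "A (J v) = J (A v)" for v
    using Jcomm[OF AY[OF refl]] by (metis blinfun_apply_blinfun_compose)
  show thesis
  proof
    show "C \<noteq> 0"
    proof
      assume "C = 0"
      then have "x0 - Y x0 + A x0 = 0"
        by (metis C_def blinfun.add_left blinfun.diff_left blinfun.zero_left blinfun_apply_id_blinfun id_apply)
      then have "inner (A x0) x0 = inner (Y x0) x0 - inner x0 x0"
        by (metis add_diff_cancel_left' diff_0 inner_diff_left minus_diff_eq)
      moreover have "inner (Y x0) x0 \<le> inner x0 x0"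
        using norm_cauchy_schwarz[of "Y x0" x0] norm_blinfun[of Y x0]
          mult_right_mono[OF Y(1) norm_ge_zero[of x0]]
        by (smt (verit) mult_right_mono norm_ge_zero power2_eq_square power2_norm_eq_inner)
      ultimately have "inner (A x0) x0 \<le> 0" by simp
      moreover have "inner x0 (V x0) = inner (U x0) x0"
        by (simp add: adj)
      ultimately have "2 * inner x0 x0 - 2 * inner (U x0) x0 \<le> 5 * e * inner x0 x0"
        by (simp add: Ax inner_diff_left inner_commute algebra_simps)
      moreover have "(norm (U x0 - x0))\<^sup>2 = 2 * inner x0 x0 - 2 * inner (U x0) x0"
        using arg_cong[OF iso(1)[of x0], of "\<lambda>r. r\<^sup>2"]
        by (simp add: power2_norm_eq_inner inner_diff_left inner_diff_right inner_commute)
      ultimately have "q \<le> 5 * e"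
        using \<open>x0 \<noteq> 0\<close> by (simp add: q_def power2_norm_eq_inner divide_le_eq)
      then show False using e by simp
    qed
    \<comment> \<open>The factor \<open>1/5\<close> on \<open>J\<close> cancels the one in
      \<open>S\<close>, so the left side is \<open>(A + e) J C\<close>. As
      \<open>A C = (1 - Y) C\<close>, this becomes \<open>(e + 1 - Y) J C = C\<close>.\<close>
    show "(2 *\<^sub>R id_blinfun - U - V) o\<^sub>L ((1/5) *\<^sub>R J) o\<^sub>L C = C"
    proof (rule blinfun_eqI)
      fix v
      have sq: "2 *\<^sub>R Y v = v - A (A v) + Y (Y v)"
        using arg_cong[OF Y(2), of "\<lambda>B. B v"] by (simp add: blinfun.bilinear_simps)
      have AC: "A (C v) = C v - Y (C v)"
        using sq by (simp add: C_def blinfun.bilinear_simps YA algebra_simps scaleR_2)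
      have "J (C v) + e *\<^sub>R J (C v) = C v + J (Y (C v))"
        using arg_cong[OF J, of "\<lambda>B. B (C v)"] by (simp add: blinfun.bilinear_simps JY scaleR_add_left)
      then have "J (C v) - J (Y (C v)) + e *\<^sub>R J (C v) = C v"
        by (simp add: algebra_simps)
      then have "A (J (C v)) + e *\<^sub>R J (C v) = C v"
        by (simp only: JA AC blinfun.diff_right)
      moreover have "((2 *\<^sub>R id_blinfun - U - V) o\<^sub>L ((1/5) *\<^sub>R J) o\<^sub>L C) v
          = A (J (C v)) + e *\<^sub>R J (C v)"
        by (simp add: Ax blinfun.bilinear_simps algebra_simps)
      ultimately show "((2 *\<^sub>R id_blinfun - U - V) o\<^sub>L ((1/5) *\<^sub>R J) o\<^sub>L C) v = C v" by simp
    qed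
  next
    fix X assume X: "X o\<^sub>L U = U o\<^sub>L X" "X o\<^sub>L V = V o\<^sub>L X"
    note XA = UVA[OF X] and XY = AY[OF UVA[OF X]] and XJ = Jcomm[OF AY[OF UVA[OF X]]]
    show "X o\<^sub>L C = C o\<^sub>L X"
      using XA XY by (intro blinfun_eqI)
        (simp add: C_def blinfun.bilinear_simps, metis blinfun_apply_blinfun_compose)
    show "X o\<^sub>L ((1/5) *\<^sub>R J) = ((1/5) *\<^sub>R J) o\<^sub>L X"
      using XJ by (intro blinfun_eqI)
        (simp add: blinfun.bilinear_simps, metis blinfun_apply_blinfun_compose)
  qed
qed

section \<open>Complex scalars, closed spans and unitary operators\<close>

lemma norm_scaleC: "norm (c *\<^sub>C x) = cmod c * norm x"
  for x :: "'a::complex_inner"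
proof -
  have "cinner (c *\<^sub>C x) (c *\<^sub>C x) = c * cnj c * cnj (cinner x x)"
    by (simp add: cinner_scaleC_left cinner_commute[of x "c *\<^sub>C x"])
  also have "\<dots> = complex_of_real ((cmod c)\<^sup>2) * cnj (cinner x x)"
    by (simp only: complex_norm_square)
  finally have "inner (c *\<^sub>C x) (c *\<^sub>C x) = (cmod c)\<^sup>2 * inner x x"
    by (simp flip: Re_cinner)
  then show ?thesis by (simp add: norm_eq_sqrt_inner real_sqrt_mult)
qed

lemma bounded_linear_scaleC: "bounded_linear (scaleC c :: 'a \<Rightarrow> 'a::complex_inner)"
proof (rule bounded_linear_intro[where K = "cmod c"])
  show "c *\<^sub>C (r *\<^sub>R x) = r *\<^sub>R (c *\<^sub>C x)" for r and x :: 'a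
    by (simp add: scaleC_scaleC mult.commute flip: scaleC_of_real)
qed (simp_all add: scaleC_add_right norm_scaleC mult.commute)

lemma closure_cspan_add:
  assumes "x \<in> closure (cspan B)" "y \<in> closure (cspan B)"
  shows "x + y \<in> closure (cspan B)"
proof -
  obtain f where "\<forall>n. f n \<in> cspan B" "f \<longlonglongrightarrow> x"
    using assms(1) unfolding closure_sequential by blast
  moreover obtain h where "\<forall>n. h n \<in> cspan B" "h \<longlonglongrightarrow> y"
    using assms(2) unfolding closure_sequential by blast
  ultimately show ?thesis unfolding closure_sequential
    by (intro exI[of _ "\<lambda>n. f n + h n"]) (simp add: complex_vector.span_add tendsto_add)
qed

lemma closure_cspan_scaleC:
  assumes "x \<in> closure (cspan B)"
  shows "c *\<^sub>C x \<in> closure (cspan B)"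
proof -
  obtain f where "\<forall>n. f n \<in> cspan B" "f \<longlonglongrightarrow> x"
    using assms unfolding closure_sequential by blast
  then show ?thesis unfolding closure_sequential
    by (intro exI[of _ "\<lambda>n. c *\<^sub>C f n"])
      (simp add: complex_vector.span_scale bounded_linear.tendsto[OF bounded_linear_scaleC])
qed

lemma clinear_add: "clinear f \<Longrightarrow> f (x + y) = f x + f y"
  and clinear_scaleC: "clinear f \<Longrightarrow> f (c *\<^sub>C x) = c *\<^sub>C f x"
  by (simp_all add: Vector_Spaces.linear_iff_module_hom module_hom.add module_hom.scale)

lemma unitary_inner:
  assumes "unitary U"
  shows "inner (U x) (U y) = inner x y"
  using assms unfolding unitary_def by (metis Re_cinner)

lemma unitary_norm: "unitary U \<Longrightarrow> norm (U x) = norm x"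
  by (simp add: norm_eq_sqrt_inner unitary_inner)

lemma unitary_bounded_linear:
  assumes "unitary U"
  shows "bounded_linear U"
proof (rule bounded_linear_intro[where K = 1])
  have U: "clinear U" using assms by (simp add: unitary_def)
  show "U (x + y) = U x + U y" for x y by (rule clinear_add[OF U])
  show "U (r *\<^sub>R x) = r *\<^sub>R U x" for r x
    using clinear_scaleC[OF U, of "complex_of_real r" x] by (simp add: scaleC_of_real)
qed (simp add: unitary_norm[OF assms])

lemma irreducible_actionD:
  assumes "irreducible_action G \<alpha>" and "w \<in> S" "closed S" "caffine S"
    and "\<And>g. g \<in> carrier G \<Longrightarrow> \<alpha> g ` S \<subseteq> S"
  shows "S = UNIV"
proof (rule ccontr)
  assume "S \<noteq> UNIV"
  with assms(2-) have "S \<noteq> {} \<and> closed S \<and> S \<noteq> UNIV \<and> caffine S \<and> (\<forall>g\<in>carrier G. \<alpha> g ` S \<subseteq> S)"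
    by (intro conjI ballI) auto
  then have "\<exists>S. S \<noteq> {} \<and> closed S \<and> S \<noteq> UNIV \<and> caffine S \<and> (\<forall>g\<in>carrier G. \<alpha> g ` S \<subseteq> S)"
    by (rule exI)
  with assms(1) show False unfolding irreducible_action_def by (rule notE)
qed

section \<open>Unitary representations and irreducible affine actions\<close>

locale unitary_rep = group G for G (structure) +
  fixes \<pi> :: "'a \<Rightarrow> 'h::chilbert_space \<Rightarrow> 'h"
  assumes unitary: "g \<in> carrier G \<Longrightarrow> unitary (\<pi> g)"
    and rep_mult: "g \<in> carrier G \<Longrightarrow> h \<in> carrier G \<Longrightarrow> \<pi> (g \<otimes> h) v = \<pi> g (\<pi> h v)"
begin

lemma rep_inj: "g \<in> carrier G \<Longrightarrow> \<pi> g v = \<pi> g w \<Longrightarrow> v = w"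
  using unitary_norm[OF unitary, of g "v - w"]
    linear_diff[OF bounded_linear.linear[OF unitary_bounded_linear[OF unitary]], of g v w] by simp

lemma rep_one: "\<pi> \<one> v = v"
  by (rule rep_inj[of \<one>]) (simp_all flip: rep_mult)

lemma rep_inv_left: "g \<in> carrier G \<Longrightarrow> \<pi> (inv g) (\<pi> g v) = v"
  using rep_mult[of "inv g" g v] by (simp add: rep_one)

lemma rep_inv_right: "g \<in> carrier G \<Longrightarrow> \<pi> g (\<pi> (inv g) v) = v"
  using rep_mult[of g "inv g" v] by (simp add: rep_one)

lemma rep_adjoint: "g \<in> carrier G \<Longrightarrow> inner (\<pi> g x) y = inner x (\<pi> (inv g) y)"
  using unitary_inner[OF unitary, of g x "\<pi> (inv g) y"] by (simp add: rep_inv_right)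

lemma rep_scaleC: "g \<in> carrier G \<Longrightarrow> \<pi> g (c *\<^sub>C x) = c *\<^sub>C \<pi> g x"
  using unitary[of g] by (simp add: unitary_def clinear_scaleC)

lemma rep_add: "g \<in> carrier G \<Longrightarrow> \<pi> g (x + y) = \<pi> g x + \<pi> g y"
  by (rule linear_add[OF bounded_linear.linear[OF unitary_bounded_linear[OF unitary]]])

lemma rep_diff: "g \<in> carrier G \<Longrightarrow> \<pi> g (x - y) = \<pi> g x - \<pi> g y"
  by (rule linear_diff[OF bounded_linear.linear[OF unitary_bounded_linear[OF unitary]]])

lemma rep_minus: "g \<in> carrier G \<Longrightarrow> \<pi> g (- x) = - \<pi> g x"
  by (rule linear_neg[OF bounded_linear.linear[OF unitary_bounded_linear[OF unitary]]])

lemma rep_zero: "g \<in> carrier G \<Longrightarrow> \<pi> g 0 = 0"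
  by (rule linear_0[OF bounded_linear.linear[OF unitary_bounded_linear[OF unitary]]])

text \<open>Otherwise the cutoff of \<open>\<pi> z\<close> gives \<open>C \<noteq> 0\<close>
  commuting with \<open>\<pi>\<close>. Applying \<open>J C\<close> to the assumed coboundary
  identity shows that \<open>C b\<close> is the coboundary of \<open>C (J c)\<close>. So
  \<open>- C (J c)\<close> is fixed by the action transported along \<open>C\<close>, and its
  preimage \<open>W\<close> under \<open>C\<close> contradicts irreducibility.\<close>

lemma rep_central_trivial:
  assumes irr: "irreducible_action G \<alpha>"
    and act: "\<And>g v. g \<in> carrier G \<Longrightarrow> \<alpha> g v = \<pi> g v + b g"
    and z: "z \<in> carrier G"
    and comm: "\<And>g v. g \<in> carrier G \<Longrightarrow> \<pi> z (\<pi> g v) = \<pi> g (\<pi> z v)"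
    and cob: "\<And>g. g \<in> carrier G \<Longrightarrow>
      2 *\<^sub>R b g - \<pi> z (b g) - \<pi> (inv z) (b g) = \<pi> g c - c"
  shows "\<pi> z v = v"
proof (rule ccontr)
  assume nontrivial: "\<pi> z v \<noteq> v"
  define P where "P g = Blinfun (\<pi> g)" for g
  have P: "blinfun_apply (P g) = \<pi> g" if "g \<in> carrier G" for g
    unfolding P_def using unitary_bounded_linear[OF unitary[OF that]] by (rule bounded_linear_Blinfun_apply)
  have iz: "inv z \<in> carrier G" using z by simp
  have comm': "\<pi> (inv z) (\<pi> g w) = \<pi> g (\<pi> (inv z) w)" if "g \<in> carrier G" for g w
    by (rule rep_inj[OF z]) (simp add: rep_inv_right z comm that)
  define U where "U = P z"
  define V where "V = P (inv z)"
  have U: "U w = \<pi> z w" and V: "V w = \<pi> (inv z) w" for w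
    using P z iz by (simp_all add: U_def V_def)
  obtain C J where C0: "C \<noteq> 0" and SJC: "(2 *\<^sub>R id_blinfun - U - V) o\<^sub>L J o\<^sub>L C = C"
    and Cc: "\<And>X. X o\<^sub>L U = U o\<^sub>L X \<Longrightarrow> X o\<^sub>L V = V o\<^sub>L X \<Longrightarrow> X o\<^sub>L C = C o\<^sub>L X"
    and Jc: "\<And>X. X o\<^sub>L U = U o\<^sub>L X \<Longrightarrow> X o\<^sub>L V = V o\<^sub>L X \<Longrightarrow> X o\<^sub>L J = J o\<^sub>L X"
  proof (rule unitary_spectral_cutoff[of U V v])
    show "U v \<noteq> v" using nontrivial by (simp add: U)
  qed (use z iz in \<open>auto simp: U V unitary_norm[OF unitary] rep_adjoint\<close>)
  have CX: "C (X w) = X (C w)" and JX: "J (X w) = X (J w)"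
    if "\<And>w. X (U w) = U (X w)" "\<And>w. X (V w) = V (X w)" for X :: "'h \<Rightarrow>\<^sub>L 'h" and w
  proof -
    have "X o\<^sub>L U = U o\<^sub>L X" "X o\<^sub>L V = V o\<^sub>L X" by (auto intro!: blinfun_eqI simp: that)
    then have "X o\<^sub>L C = C o\<^sub>L X" "X o\<^sub>L J = J o\<^sub>L X" by (rule Cc Jc; assumption)+
    then show "C (X w) = X (C w)" "J (X w) = X (J w)"
      by (metis blinfun_apply_blinfun_compose)+
  qed
  have UV: "U (V w) = w" "V (U w) = w" for w
    by (simp_all add: U V rep_inv_left rep_inv_right z)
  \<comment> \<open>Here \<open>X\<close> is \<open>U\<close> or \<open>V\<close>; for
    \<open>JC\<close> below it is \<open>C\<close>.\<close>
  have CU: "C (U w) = U (C w)" and CV: "C (V w) = V (C w)"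
    and JU: "J (U w) = U (J w)" and JV: "J (V w) = V (J w)" for w
    by (intro CX JX; simp add: UV)+
  have JC: "J (C w) = C (J w)" for w by (rule JX) (simp_all add: CU CV)
  have C\<pi>: "C (\<pi> g w) = \<pi> g (C w)" and J\<pi>: "J (\<pi> g w) = \<pi> g (J w)"
    if "g \<in> carrier G" for g w
    using CX[of "P g" w] JX[of "P g" w] by (simp_all add: P U V that comm comm')
  \<comment> \<open>\<open>C\<close> is only known to be real linear. Complex linearity, needed for
    \<open>caffine W\<close>, comes from commutation with multiplication by \<open>a\<close>, viewed
    as a real operator.\<close>
  have Csc: "C (a *\<^sub>C w) = a *\<^sub>C C w" for a w
  proof -
    define Q :: "'h \<Rightarrow>\<^sub>L 'h" where "Q = Blinfun (scaleC a)"
    have "blinfun_apply Q = scaleC a"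
      unfolding Q_def by (rule bounded_linear_Blinfun_apply[OF bounded_linear_scaleC])
    then show ?thesis using CX[of Q w] by (simp add: U V rep_scaleC z iz)
  qed
  have Cb: "C (b g) = \<pi> g (C (J c)) - C (J c)" if g: "g \<in> carrier G" for g
  proof -
    have "C (b g) = 2 *\<^sub>R J (C (b g)) - U (J (C (b g))) - V (J (C (b g)))"
      using arg_cong[OF SJC, of "\<lambda>B. B (b g)"] by (simp add: blinfun.bilinear_simps)
    also have "\<dots> = J (C (2 *\<^sub>R b g - U (b g) - V (b g)))"
      by (simp add: blinfun.bilinear_simps CU CV JU JV)
    also have "\<dots> = J (C (\<pi> g c - c))" using cob[OF g] by (simp add: U V)
    also have "\<dots> = \<pi> g (C (J c)) - C (J c)"
      by (simp add: blinfun.bilinear_simps C\<pi> J\<pi> g JC)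
    finally show ?thesis .
  qed
  define W where "W = {w. C w = - C (J c)}"
  have mem: "- J c \<in> W" by (simp add: W_def blinfun.bilinear_simps)
  have closed: "closed W"
    unfolding W_def by (intro closed_Collect_eq continuous_intros)
  have affine: "caffine W"
  proof -
    have "x *\<^sub>C u + y *\<^sub>C u = u" if "x + y = 1" for x y and u :: 'h
      using that by (simp flip: scaleC_add_left)
    then show ?thesis
      by (auto simp only: caffine_def W_def blinfun.add_right Csc mem_Collect_eq)
  qed
  have inv: "\<alpha> g ` W \<subseteq> W" if g: "g \<in> carrier G" for g
    by (auto simp: W_def act g blinfun.add_right C\<pi> Cb rep_minus)
  have "W = UNIV" by (rule irreducible_actionD[OF irr mem closed affine inv])
  \<comment> \<open>Now \<open>C\<close> is constant, and its value at \<open>0\<close> is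
    \<open>0\<close>.\<close>
  then have "C w = - C (J c)" for w by (auto simp: W_def)
  then have "C w = 0" for w by (metis blinfun.zero_right)
  then have "C = 0" by (intro blinfun_eqI) simp
  with C0 show False by simp
qed

text \<open>Downward induction along the lower central series. The conclusion on \<open>b\<close> is only that its
  values there are \<open>\<pi>(G)\<close>-fixed, which stands in for passing to the quotient by the fixed
  vectors.\<close>

lemma irreducible_lower_central_series:
  assumes irr: "irreducible_action G \<alpha>"
    and act: "\<And>g v. g \<in> carrier G \<Longrightarrow> \<alpha> g v = \<pi> g v + b g"
    and coc: "\<And>g h. g \<in> carrier G \<Longrightarrow> h \<in> carrier G \<Longrightarrow> b (g \<otimes> h) = b g + \<pi> g (b h)"
    and next_term: "\<And>x g v. x \<in> lower_central_series G (Suc n) \<Longrightarrow> g \<in> carrier G \<Longrightarrow>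
      \<pi> x v = v \<and> \<pi> g (b x) = b x"
    and z: "z \<in> carrier G" "z \<in> lower_central_series G n" and g: "g \<in> carrier G"
  shows "\<pi> z v = v \<and> \<pi> g (b z) = b z"
proof -
  have iz: "inv z \<in> carrier G" using z by simp
  \<comment> \<open>The commutator of \<open>z\<close> and \<open>h\<close> lies in the next term,
    where \<open>\<pi>\<close> is trivial; hence \<open>\<pi> z\<close> commutes with
    \<open>\<pi> h\<close>.\<close>
  define k where "k h = z \<otimes> h \<otimes> inv z \<otimes> inv h" for h
  have kc: "k h \<in> carrier G" "z \<otimes> h = k h \<otimes> (h \<otimes> z)" if "h \<in> carrier G" for h
    using that z by (simp_all add: k_def m_assoc) (simp flip: m_assoc)
  have kl: "k h \<in> lower_central_series G (Suc n)" if "h \<in> carrier G" for h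
    using that z by (auto simp: k_def intro!: generate.incl)
  have comm: "\<pi> z (\<pi> h w) = \<pi> h (\<pi> z w)" if h: "h \<in> carrier G" for h w
  proof -
    have "\<pi> z (\<pi> h w) = \<pi> (k h) (\<pi> (h \<otimes> z) w)"
      using rep_mult[of z h w] rep_mult[of "k h" "h \<otimes> z" w] kc[OF h] h z by simp
    then show ?thesis using next_term[OF kl[OF h] h] rep_mult h z by simp
  qed
  have comm': "\<pi> (inv z) (\<pi> h w) = \<pi> h (\<pi> (inv z) w)" if "h \<in> carrier G" for h w
    by (rule rep_inj[OF z(1)]) (simp add: rep_inv_right z comm that)
  have bcomm: "b z + \<pi> z (b h) = b (k h) + (b h + \<pi> h (b z))" if h: "h \<in> carrier G" for h
  proof -
    have "b z + \<pi> z (b h) = b (k h \<otimes> (h \<otimes> z))" using coc[of z h] kc[OF h] h z by simp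
    also have "\<dots> = b (k h) + \<pi> (k h) (b (h \<otimes> z))" using kc[OF h] h z by (intro coc) auto
    finally show ?thesis using next_term[OF kl[OF h] h] coc h z by simp
  qed
  have bk: "\<pi> g (b (k h)) = b (k h)" if "g \<in> carrier G" "h \<in> carrier G" for g h
    using next_term[OF kl] that by blast
  have triv: "\<pi> z v = v" for v
  proof (rule rep_central_trivial[OF irr act z(1) comm])
    fix h assume h: "h \<in> carrier G"
    have 1: "\<pi> z (b h) - b h = b (k h) + \<pi> h (b z) - b z"
      using bcomm[OF h] by (simp add: algebra_simps)
    \<comment> \<open>The term \<open>b (k h)\<close> is fixed by \<open>\<pi> (inv z)\<close>, so
      it cancels when fact \<open>1\<close> is subtracted from its image under
      \<open>\<pi> (inv z)\<close>. This is why the symmetric operator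
      \<open>2 - \<pi> z - \<pi> (inv z)\<close> is used; what remains is the coboundary of
      \<open>\<pi> (inv z) (b z) - b z\<close>.\<close>
    have "\<pi> (inv z) (\<pi> z (b h) - b h) = \<pi> (inv z) (b (k h) + \<pi> h (b z) - b z)"
      by (simp only: 1)
    then have "b h - \<pi> (inv z) (b h) = b (k h) + \<pi> h (\<pi> (inv z) (b z)) - \<pi> (inv z) (b z)"
      using rep_add[OF iz] rep_diff[OF iz] rep_inv_left[OF z(1)] bk[OF iz h] comm'[OF h] by simp
    then show "2 *\<^sub>R b h - \<pi> z (b h) - \<pi> (inv z) (b h)
        = \<pi> h (\<pi> (inv z) (b z) - b z) - (\<pi> (inv z) (b z) - b z)"
      using 1 by (simp add: rep_diff h scaleR_2) (simp add: algebra_simps)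
  qed auto
  \<comment> \<open>Since \<open>\<pi> z\<close> is trivial, \<open>d = - b (k g)\<close> is a fixed
    vector. Vectors of the form \<open>\<pi> g x - x\<close> are orthogonal to fixed vectors, so
    \<open>d\<close> is orthogonal to itself.\<close>
  define d where "d = \<pi> g (b z) - b z"
  have "d = - b (k g)" using bcomm[OF g] by (simp add: triv d_def algebra_simps eq_neg_iff_add_eq_0)
  then have "\<pi> (inv g) d = d" using bk[of "inv g" g] g by (simp add: rep_minus)
  then have "inner (\<pi> g (b z)) d = inner (b z) d" using rep_adjoint[OF g] by simp
  then have "inner d d = 0" by (simp add: d_def inner_diff_left)
  then show ?thesis using triv by (simp add: d_def)
qed

end

section \<open>Descent along the central series and density of the span\<close>

theorem corollary4p16:
  fixes G :: "('g, 'm) monoid_scheme" and T :: "'g topology"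
    and \<alpha> :: "'g \<Rightarrow> 'h::chilbert_space \<Rightarrow> 'h"
  assumes "topological_group G T" and "nilpotent_group G"
    and "affine_isometric_action G T \<alpha>" and "irreducible_action G \<alpha>"
  shows "\<exists>b. continuous_additive_hom G T b \<and>
             closure (cspan (b ` carrier G)) = UNIV \<and>
             (\<forall>g\<in>carrier G. \<forall>v. \<alpha> g v = v + b g)"
proof -
  interpret nilpotent_group G by fact
  obtain \<pi> b where rep: "continuous_unitary_rep G T \<pi>" and coc: "continuous_cocycle G T \<pi> b"
    and act: "\<And>g v. g \<in> carrier G \<Longrightarrow> \<alpha> g v = \<pi> g v + b g"
    using assms(3) unfolding affine_isometric_action_def by blast
  interpret unitary_rep G \<pi>
    using rep by unfold_locales (auto simp: continuous_unitary_rep_def)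
  have bmult: "\<And>g h. g \<in> carrier G \<Longrightarrow> h \<in> carrier G \<Longrightarrow> b (g \<otimes>\<^bsub>G\<^esub> h) = b g + \<pi> g (b h)"
    using coc by (simp add: continuous_cocycle_def)
  have lcs: "lower_central_series G n \<subseteq> carrier G" for n
  proof (induction n)
    case (Suc n)
    then show ?case unfolding lower_central_series.simps by (intro generate_incl) auto
  qed simp
  obtain N where N: "lower_central_series G N = {\<one>\<^bsub>G\<^esub>}" using nilpotent by blast
  \<comment> \<open>The index \<open>N - i\<close> moves from the trivial term up to
    \<open>G\<close> itself, reached at \<open>i = N\<close>. Beyond that, truncated subtraction
    keeps it at \<open>0\<close> and the claim repeats.\<close>
  have "\<forall>x\<in>lower_central_series G (N - i). \<forall>g\<in>carrier G. \<forall>v. \<pi> x v = v \<and> \<pi> g (b x) = b x" for i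
  proof (induction i)
    case 0
    have "b \<one>\<^bsub>G\<^esub> = 0" using bmult[of "\<one>\<^bsub>G\<^esub>" "\<one>\<^bsub>G\<^esub>"] by (simp add: rep_one)
    then show ?case by (simp add: N rep_one rep_zero)
  next
    case (Suc i)
    show ?case
    proof (cases "i < N")
      case True
      then have "N - i = Suc (N - Suc i)" by simp
      with Suc have "\<pi> x v = v \<and> \<pi> g (b x) = b x"
        if "x \<in> lower_central_series G (Suc (N - Suc i))" "g \<in> carrier G" for x g v
        using that by (simp only:)
      from irreducible_lower_central_series[OF assms(4) act bmult this] lcs show ?thesis by blast
    next
      case False
      then show ?thesis using Suc by simp
    qed
  qed
  from this[of N] have triv: "\<pi> g v = v" if "g \<in> carrier G" for g v
    using that by simp
  define S where "S = closure (cspan (b ` carrier G))"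
  have sum: "x + y \<in> S" if "x \<in> S" "y \<in> S" for x y
    using that unfolding S_def by (rule closure_cspan_add)
  have scale: "c *\<^sub>C x \<in> S" if "x \<in> S" for c x
    using that unfolding S_def by (rule closure_cspan_scaleC)
  have bS: "b g \<in> S" if "g \<in> carrier G" for g
    unfolding S_def using that
    by (intro subsetD[OF closure_subset] complex_vector.span_base imageI)
  have "S = UNIV"
  \<comment> \<open>With \<open>\<pi>\<close> trivial, each \<open>\<alpha> g\<close> is translation
    by \<open>b g\<close>, which preserves the closed subspace \<open>S\<close>.\<close>
  proof (rule irreducible_actionD[OF assms(4) bS[OF one_closed]])
    show "closed S" by (simp add: S_def)
    show "caffine S" using sum scale by (simp add: caffine_def)
    show "\<alpha> g ` S \<subseteq> S" if "g \<in> carrier G" for g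
      using that by (auto simp: act triv intro!: sum bS)
  qed
  moreover have "continuous_additive_hom G T b"
    using coc by (simp add: continuous_additive_hom_def continuous_cocycle_def triv)
  moreover have "\<forall>g\<in>carrier G. \<forall>v. \<alpha> g v = v + b g" by (simp add: act triv)
  ultimately show ?thesis unfolding S_def by blast
qed

end
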